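(* Let $G$ be a connected $[4,2]$-graph of order $n\ge 8$. Then $e(G)\ge \lfloor (n-1)^2/4\rfloor+1$, with equality if and only if $G$ is isomorphic to $B_n$.
   Context: All graphs are finite and simple. $e(G)$ denotes the number of edges of $G$. For a positive integer $s$ and a nonnegative integer $t$, a graph $G$ of order at least $s$ is called an $[s,t]$-graph if every induced subgraph of $G$ on $s$ vertices has at least $t$ edges. $B_n$ (the barbell graph) is the graph obtained from the vertex-disjoint union of complete graphs $K_{\lfloor n/2\rfloor}$ and $K_{\lceil n/2\rceil}$ by adding one edge joining the two cliques. *)

theory Defs
  imports "Graph_Theory.Graph_Theory"
begin

text \<open>
  A finite simple graph is a \<^locale>\<open>graph\<close>: a finite symmetric digraph without loops
  and without parallel arcs. Each undirected edge \<open>uv\<close> is represented by the two opposite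
  arcs \<open>(u,v)\<close> and \<open>(v,u)\<close>, so edges are counted as unordered pairs of ends.
\<close>

definition num_edges :: "('a, 'b) pre_digraph \<Rightarrow> nat" where
  "num_edges G = card ((\<lambda>a. {tail G a, head G a}) ` arcs G)"

definition st_graph :: "nat \<Rightarrow> nat \<Rightarrow> ('a, 'b) pre_digraph \<Rightarrow> bool" where
  "st_graph s t G \<longleftrightarrow>
     card (verts G) \<ge> s \<and>
     (\<forall>H. induced_subgraph H G \<and> card (verts H) = s \<longrightarrow> num_edges H \<ge> t)"

definition complete_on :: "'a set \<Rightarrow> 'a pair_pre_digraph" where
  "complete_on S = \<lparr>pverts = S, parcs = {(u, v). u \<in> S \<and> v \<in> S \<and> u \<noteq> v}\<rparr>"

lemma complete_digraph_complete_on: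
  assumes "finite S"
  shows "complete_digraph (card S) (with_proj (complete_on S))"
  using assms unfolding complete_digraph_pair_def by (auto simp: complete_on_def)

text \<open>
  The barbell graph on the vertices \<open>0, \<dots>, n - 1\<close>: the cliques are on the first
  \<open>n div 2\<close> vertices and on the remaining \<open>n - n div 2\<close> vertices (half of \<open>n\<close>, rounded down
  and up), and the joining edge has the ends \<open>0\<close> and \<open>n div 2\<close>. All choices of the joining
  edge give isomorphic graphs. It is only meaningful for \<open>n \<ge> 2\<close>.
\<close>

definition barbell :: "nat \<Rightarrow> nat pair_pre_digraph" where
  "barbell n =
     (let A = complete_on {0..<n div 2}; B = complete_on {n div 2..<n}
      in \<lparr>pverts = pverts A \<union> pverts B,
          parcs = parcs A \<union> parcs B \<union> {(0, n div 2), (n div 2, 0)}\<rparr>)"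

lemma pair_graph_barbell:
  assumes "n \<ge> 2"
  shows "pair_graph (barbell n)"
proof
  show "finite (parcs (barbell n))"
    by (rule finite_subset[of _ "{0..<n} \<times> {0..<n}"])
      (use assms in \<open>auto simp: barbell_def complete_on_def Let_def\<close>)
  show "symmetric (with_proj (barbell n))"
    unfolding symmetric_def by (auto simp: barbell_def complete_on_def sym_def Let_def)
qed (use assms in \<open>auto simp: barbell_def complete_on_def Let_def\<close>)

end

theory Submission
  imports Defs
begin

text \<open>
  In the complement of a [4,2]-graph no two triangles share an edge. Deleting a triangle costs at
  most \<open>n\<close> edges, since every other vertex sees at most one of its corners; by induction such
  graphs have at most \<open>n\<^sup>2 div 4\<close> edges, and noticeably fewer if there is a triangle at all. A
  triangle-free graph is split into the neighbourhood \<open>A\<close> of a vertex of maximum degree and the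
  rest \<open>T\<close>. Summing degrees over \<open>T\<close> counts the edges inside \<open>T\<close> twice, so the number of edges of
  the graph plus the number inside \<open>T\<close> is at most \<open>|T| |A|\<close>. With at least \<open>n\<^sup>2 div 4 - 1\<close> edges
  this forces the complement to be bipartite, i.e. the graph itself consists of two cliques and
  some edges between them; connectedness provides such an edge, and the count leaves no room for
  a second one or for unbalanced cliques.
\<close>

section \<open>Degree sums for a symmetric irreflexive relation\<close>

locale adjacency =
  fixes E :: "'a \<Rightarrow> 'a \<Rightarrow> bool"
  assumes E_sym: "E u v \<Longrightarrow> E v u"
    and E_irrefl: "\<not> E u u"
begin

definition nbrs :: "'a set \<Rightarrow> 'a \<Rightarrow> 'a set" where
  "nbrs A u = {w \<in> A. E u w}"

text \<open>Edges inside \<open>A \<inter> B\<close> are counted twice, so \<open>ecount S S\<close> is twice the number of edges in \<open>S\<close>.\<close>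

definition ecount :: "'a set \<Rightarrow> 'a set \<Rightarrow> nat" where
  "ecount A B = (\<Sum>u\<in>A. card (nbrs B u))"

text \<open>\<open>c\<close> and \<open>d\<close> may be adjacent, so the shared edge
  \<open>ab\<close> is excluded in a non-induced sense and complete graphs on four vertices are
  excluded too.\<close>

definition diamond_free :: "'a set \<Rightarrow> bool" where
  "diamond_free S \<longleftrightarrow>
     (\<forall>a\<in>S. \<forall>b\<in>S. \<forall>c\<in>S. \<forall>d\<in>S. E a b \<and> E a c \<and> E b c \<and> E a d \<and> E b d \<longrightarrow> c = d)"

definition triangle_free :: "'a set \<Rightarrow> bool" where
  "triangle_free S \<longleftrightarrow> (\<forall>a\<in>S. \<forall>b\<in>S. \<forall>c\<in>S. \<not> (E a b \<and> E a c \<and> E b c))"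

lemma card_nbrs_Un:
  assumes "finite A" "finite B" "A \<inter> B = {}"
  shows "card (nbrs (A \<union> B) u) = card (nbrs A u) + card (nbrs B u)"
proof -
  have "nbrs (A \<union> B) u = nbrs A u \<union> nbrs B u" by (auto simp: nbrs_def)
  then show ?thesis using assms by (auto simp: nbrs_def intro!: card_Un_disjoint)
qed

lemma ecount_commute:
  assumes "finite A" "finite B"
  shows "ecount A B = ecount B A"
proof -
  have "ecount X Y = (\<Sum>u\<in>X. \<Sum>w\<in>Y. if E u w then 1 else 0)" if "finite Y" for X Y
    unfolding ecount_def nbrs_def using that by (simp only: card_eq_sum sum.inter_filter)
  moreover have "(\<Sum>u\<in>A. \<Sum>w\<in>B. if E u w then 1 else (0::nat)) = (\<Sum>w\<in>B. \<Sum>u\<in>A. if E w u then 1 else 0)"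
    by (subst sum.swap) (auto intro!: sum.cong dest: E_sym)
  ultimately show ?thesis using assms by simp
qed

lemma ecount_Un_right:
  assumes "finite A" "finite B" "A \<inter> B = {}"
  shows "ecount C (A \<union> B) = ecount C A + ecount C B"
  by (simp add: ecount_def card_nbrs_Un[OF assms] sum.distrib)

lemma ecount_Un_self:
  assumes "finite A" "finite B" "A \<inter> B = {}"
  shows "ecount (A \<union> B) (A \<union> B) = ecount A A + ecount B B + 2 * ecount A B"
proof -
  have "ecount (A \<union> B) (A \<union> B) = ecount A (A \<union> B) + ecount B (A \<union> B)"
    using assms by (simp add: ecount_def sum.union_disjoint)
  then show ?thesis
    using assms ecount_commute[of A B] by (simp add: ecount_Un_right)
qed

lemma even_ecount:
  assumes "finite A"
  shows "even (ecount A A)"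
  using assms
proof induction
  case empty
  then show ?case by (simp add: ecount_def)
next
  case (insert x A)
  have "ecount {x} {x} = 0" using E_irrefl by (simp add: ecount_def nbrs_def)
  then show ?case using ecount_Un_self[of "{x}" A] insert by simp
qed

lemma ecount_le:
  assumes "\<And>u. u \<in> A \<Longrightarrow> card (nbrs B u) \<le> k"
  shows "ecount A B \<le> card A * k"
  using sum_bounded_above[of A "\<lambda>u. card (nbrs B u)" k] assms by (simp add: ecount_def)

lemma ecount_eq_0_iff:
  assumes "finite A" "finite B"
  shows "ecount A B = 0 \<longleftrightarrow> (\<forall>u\<in>A. \<forall>w\<in>B. \<not> E u w)"
  using assms by (auto simp: ecount_def nbrs_def)

section \<open>Removing a triangle and splitting a triangle-free graph\<close>

lemma diamond_free_subset: "diamond_free S \<Longrightarrow> T \<subseteq> S \<Longrightarrow> diamond_free T"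
  unfolding diamond_free_def by (meson subsetD)

text \<open>A vertex outside the triangle adjacent to two of its corners would create a second
  triangle on their common edge. So at most \<open>card R\<close> edges leave the triangle, and
  three lie inside it.\<close>

lemma ecount_remove_triangle:
  assumes "finite S" "diamond_free S" "\<not> triangle_free S"
  obtains R where "R \<subseteq> S" "card S = card R + 3" "ecount S S \<le> ecount R R + 2 * card S"
proof -
  obtain x y z where xyz: "x \<in> S" "y \<in> S" "z \<in> S" "E x y" "E x z" "E y z"
    using assms(3) by (auto simp: triangle_free_def)
  have ne: "x \<noteq> y" "x \<noteq> z" "y \<noteq> z" using xyz E_irrefl by auto
  define T where "T = {x, y, z}"
  define R where "R = S - T"
  have T: "finite T" "card T = 3" "T \<subseteq> S" using ne xyz by (auto simp: T_def)
  have R: "finite R" "R \<inter> T = {}" "R \<union> T = S" using assms(1) T by (auto simp: R_def)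
  have cS: "card S = card R + 3" using card_Un_disjoint[of R T] R T by simp
  have df: "c = d" if "E a b" "E a c" "E b c" "E a d" "E b d" "a \<in> S" "b \<in> S" "c \<in> S" "d \<in> S"
    for a b c d using assms(2) that unfolding diamond_free_def by blast
  have "card (nbrs T w) \<le> 1" if "w \<in> R" for w
  proof -
    have w: "w \<in> S" "w \<noteq> x" "w \<noteq> y" "w \<noteq> z" using that by (auto simp: R_def T_def)
    \<comment> \<open>In each instance of \<open>df\<close> the first two vertices are the shared
      edge, and the third corner and \<open>w\<close> are the two tips.\<close>
    have "\<not> (E w x \<and> E w y)" "\<not> (E w x \<and> E w z)" "\<not> (E w y \<and> E w z)"
      using df[of x y z w] df[of x z y w] df[of y z x w] w xyz E_sym by blast+
    then have "nbrs T w \<subseteq> {x} \<or> nbrs T w \<subseteq> {y} \<or> nbrs T w \<subseteq> {z}"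
      by (auto simp: nbrs_def T_def)
    then show ?thesis
      by (metis card.empty card_mono finite.emptyI finite.insertI is_singletonI is_singleton_altdef)
  qed
  then have RT: "ecount R T \<le> card R" using ecount_le[of R T 1] by simp
  have "card (nbrs T u) \<le> 2" if "u \<in> T" for u
  proof -
    have "nbrs T u \<subseteq> T - {u}" using E_irrefl by (auto simp: nbrs_def)
    then have "card (nbrs T u) \<le> card (T - {u})" using T by (intro card_mono) auto
    then show ?thesis using T that by simp
  qed
  then have TT: "ecount T T \<le> 6" using ecount_le[of T T 2] T by simp
  have "ecount S S = ecount R R + ecount T T + 2 * ecount R T"
    using ecount_Un_self[of R T] R T by simp
  \<comment> \<open>The loss \<open>6 + 2 * card R\<close> is exactly
    \<open>2 * card S\<close>.\<close>
  then have "ecount S S \<le> ecount R R + 2 * card S" using RT TT cS by simp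
  then show ?thesis using that[of R] cS R by auto
qed

text \<open>This is the core of Mantel's argument. The neighbourhood \<open>A\<close> of a vertex of
  maximum degree is independent, so every edge meets \<open>T\<close>; degrees summed over
  \<open>T\<close> count the edges inside \<open>T\<close> twice and all others once.\<close>

lemma triangle_free_split:
  assumes "finite S" "triangle_free S" "S \<noteq> {}"
  obtains A T where "S = A \<union> T" "A \<inter> T = {}" "T \<noteq> {}" "\<And>a b. a \<in> A \<Longrightarrow> b \<in> A \<Longrightarrow> \<not> E a b"
    "ecount S S + ecount T T = 2 * ecount T S" "\<And>u. u \<in> S \<Longrightarrow> card (nbrs S u) \<le> card A"
proof -
  obtain v where v: "v \<in> S" "\<And>u. u \<in> S \<Longrightarrow> card (nbrs S u) \<le> card (nbrs S v)"
  proof -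
    have "finite ((\<lambda>u. card (nbrs S u)) ` S)" "(\<lambda>u. card (nbrs S u)) ` S \<noteq> {}"
      using assms by auto
    then obtain v where "v \<in> S" "card (nbrs S v) = Max ((\<lambda>u. card (nbrs S u)) ` S)"
      using Max_in by (metis (no_types, lifting) imageE)
    then show ?thesis using that[of v] assms(1) by simp
  qed
  define A where "A = nbrs S v"
  define T where "T = S - A"
  have sp: "S = A \<union> T" "A \<inter> T = {}" "finite A" "finite T"
    using assms(1) by (auto simp: A_def T_def nbrs_def)
  have "v \<in> T" using v E_irrefl by (auto simp: T_def A_def nbrs_def)
  have ind: "\<not> E a b" if "a \<in> A" "b \<in> A" for a b
    using that v(1) assms(2) unfolding triangle_free_def A_def nbrs_def by blast
  have "ecount A A = 0" using sp ind by (simp add: ecount_eq_0_iff)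
  moreover have "ecount T S = ecount T A + ecount T T" using sp ecount_Un_right by metis
  moreover have "ecount S S = ecount A A + ecount T T + 2 * ecount A T"
    using sp ecount_Un_self by metis
  ultimately have "ecount S S + ecount T T = 2 * ecount T S"
    using ecount_commute[of A T] sp by simp
  moreover have "card (nbrs S u) \<le> card A" if "u \<in> S" for u
    using v(2)[OF that] by (simp add: A_def)
  ultimately show ?thesis using \<open>v \<in> T\<close> by (intro that[OF sp(1,2) _ ind]) auto
qed

lemma four_mult_le_square: "4 * (a * b) \<le> (a + b)\<^sup>2" for a b :: nat
proof -
  \<comment> \<open>The difference is taken in the integers because subtraction on naturals
    truncates.\<close>
  have "0 \<le> (int a - int b)\<^sup>2" by simp
  then have "4 * (int a * int b) \<le> (int a + int b)\<^sup>2" by (simp add: power2_eq_square algebra_simps)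
  then show ?thesis by (metis (mono_tags, opaque_lifting) of_nat_add of_nat_le_iff of_nat_mult of_nat_numeral of_nat_power)
qed

section \<open>Extremal bound and near-extremal structure\<close>

text \<open>Triangle-free sets satisfy Mantel's bound; otherwise a triangle is removed and induction
  applies. Size 3 is a true exception: a triangle has
  \<open>2 * ecount S S = 12 > 9\<close>.\<close>

lemma diamond_free_bound:
  assumes "finite S" "diamond_free S" "card S \<noteq> 3"
  shows "2 * ecount S S \<le> (card S)\<^sup>2"
  using assms
proof (induction "card S" arbitrary: S rule: less_induct)
  case less
  show ?case
  proof (cases "triangle_free S")
    case True
    show ?thesis
    proof (cases "S = {}")
      case True
      then show ?thesis by (simp add: ecount_def)
    next
      case False
      then obtain A T where AT: "S = A \<union> T" "A \<inter> T = {}" "ecount S S + ecount T T = 2 * ecount T S"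
        "\<And>u. u \<in> S \<Longrightarrow> card (nbrs S u) \<le> card A"
        using triangle_free_split[OF less(2) True] by metis
      have "ecount T S \<le> card T * card A" using AT by (intro ecount_le) auto
      moreover have "card S = card T + card A"
        using AT less(2) card_Un_disjoint[of A T] by simp
      ultimately show ?thesis using AT(3) four_mult_le_square[of "card T" "card A"] by simp
    qed
  next
    case False
    then obtain R where R: "R \<subseteq> S" "card S = card R + 3" "ecount S S \<le> ecount R R + 2 * card S"
      using ecount_remove_triangle[OF less(2,3)] by metis
    have fin: "finite R" and df: "diamond_free R"
      using R less finite_subset diamond_free_subset by auto
    show ?thesis
    proof (cases "card R = 3")
      case True
      have "card (nbrs R u) \<le> 2" if "u \<in> R" for u
      proof -
        have "nbrs R u \<subseteq> R - {u}" using E_irrefl by (auto simp: nbrs_def)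
        then have "card (nbrs R u) \<le> card (R - {u})" using fin by (intro card_mono) auto
        then show ?thesis using True that by simp
      qed
      then have "ecount R R \<le> 6" using ecount_le[of R R 2] True by simp
      then show ?thesis using R True by simp
    next
      case False
      then have IH: "2 * ecount R R \<le> (card R)\<^sup>2" using less(1)[of R] fin df R by simp
      have ge: "card R \<ge> 1" using R(2) less(4) by simp
      \<comment> \<open>With \<open>r = card R\<close>, the estimate
        \<open>r\<^sup>2 + 4 * (r + 3) \<le> (r + 3)\<^sup>2\<close> needs \<open>r \<ge> 2\<close>.
        For \<open>r = 1\<close> the induction hypothesis rounds down to
        \<open>ecount R R = 0\<close>.\<close>
      show ?thesis
      proof (cases "card R = 1")
        case True
        then show ?thesis using IH R by simp
      next
        case False
        define k where "k = card R - 2"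
        have k: "card R = k + 2" using ge False by (simp add: k_def)
        show ?thesis using IH R unfolding k by (simp add: power2_eq_square algebra_simps)
      qed
    qed
  qed
qed

text \<open>As \<open>ecount\<close> counts doubly, \<open>many\<close> allows one edge fewer than
  the maximum. A triangle costs more than that, and an edge inside \<open>T\<close> uses up all the
  slack, which forces an impossible degree pattern.\<close>

lemma diamond_free_extremal:
  assumes "finite S" "diamond_free S" "card S \<ge> 8"
    and many: "ecount S S + 2 \<ge> 2 * ((card S)\<^sup>2 div 4)"
  obtains A B where "S = A \<union> B" "A \<inter> B = {}" "A \<noteq> {}" "B \<noteq> {}"
    "\<And>u w. u \<in> A \<Longrightarrow> w \<in> A \<Longrightarrow> \<not> E u w" "\<And>u w. u \<in> B \<Longrightarrow> w \<in> B \<Longrightarrow> \<not> E u w"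
proof -
  define n where "n = card S"
  define M where "M = n\<^sup>2 div 4"
  have n: "n \<ge> 8" using assms n_def by simp
  have M: "4 * M \<le> n\<^sup>2" "n\<^sup>2 \<le> 4 * M + 3" unfolding M_def by presburger+
  have n2: "8 * n \<le> n\<^sup>2" using n by (simp add: power2_eq_square)
  have tf: "triangle_free S"
  proof (rule ccontr)
    assume "\<not> triangle_free S"
    then obtain R where R: "R \<subseteq> S" "card S = card R + 3" "ecount S S \<le> ecount R R + 2 * card S"
      using ecount_remove_triangle[OF assms(1,2)] by metis
    define r where "r = card R"
    have nr: "n = r + 3" "r \<ge> 5" using R n n_def r_def by auto
    have fR: "finite R" using R assms(1) finite_subset by auto
    have "diamond_free R" using R(1) assms(2) diamond_free_subset by blast
    then have b: "2 * ecount R R \<le> r\<^sup>2"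
      using diamond_free_bound[of R] fR nr r_def by simp
    have ev: "even (ecount R R)" using even_ecount fR by auto
    have "2 * M \<le> ecount R R + 2 * n + 2" using many R n_def M_def by simp
    then have c: "n\<^sup>2 \<le> 2 * ecount R R + 4 * n + 7" using M by simp
    have sq: "n\<^sup>2 = r\<^sup>2 + 6 * r + 9" unfolding nr by (simp add: power2_eq_square algebra_simps)
    \<comment> \<open>The three facts give
      \<open>r\<^sup>2 + 6 * r + 9 \<le> r\<^sup>2 + 4 * r + 19\<close>, so only
      \<open>n = 8\<close> survives.\<close>
    have r: "r = 5" using b c sq nr by linarith
    have "n = 8" using r nr by simp
    \<comment> \<open>Here \<open>M = 16\<close>, so \<open>ecount R R\<close> would be at least 14,
      while \<open>b\<close> allows at most 12.\<close>
    then have "32 \<le> ecount R R + 18" using \<open>2 * M \<le> ecount R R + 2 * n + 2\<close> M_def by simp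
    then show False using b r ev by simp
  qed
  obtain A T where AT: "S = A \<union> T" "A \<inter> T = {}" "T \<noteq> {}" "\<And>a b. a \<in> A \<Longrightarrow> b \<in> A \<Longrightarrow> \<not> E a b"
    "ecount S S + ecount T T = 2 * ecount T S" "\<And>u. u \<in> S \<Longrightarrow> card (nbrs S u) \<le> card A"
    using triangle_free_split[OF assms(1) tf] assms(3) by (metis card.empty not_numeral_le_zero)
  have fin: "finite A" "finite T" using AT(1) assms(1) by auto
  have cn: "n = card T + card A" using AT card_Un_disjoint[of A T] fin n_def by simp
  have TS: "ecount T S \<le> card T * card A" using AT by (intro ecount_le) auto
  have TA: "4 * (card T * card A) \<le> n\<^sup>2" using four_mult_le_square[of "card T" "card A"] cn by simp
  have TM: "card T * card A \<le> M" using TA M_def by simp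
  have many': "ecount S S + 2 \<ge> 2 * M" using many M_def n_def by simp
  have "A \<noteq> {}"
  proof
    assume "A = {}"
    then have "ecount S S = 0" using TS AT(5) by simp
    then show False using many' M n2 n by simp
  qed
  moreover have "\<not> E x y" if xy: "x \<in> T" "y \<in> T" for x y
  proof
    assume E: "E x y"
    have ne: "x \<noteq> y" using E E_irrefl by auto
    have pos: "1 \<le> card (nbrs T x)" "1 \<le> card (nbrs T y)"
      using E E_sym xy fin by (auto simp: nbrs_def Suc_le_eq card_gt_0_iff)
    have "{x, y} \<subseteq> T" using xy by auto
    then have "(\<Sum>u\<in>{x,y}. card (nbrs T u)) \<le> ecount T T"
      unfolding ecount_def using fin by (intro sum_mono2) auto
    then have two: "card (nbrs T x) + card (nbrs T y) \<le> ecount T T" using ne by simp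
    \<comment> \<open>The chain \<open>2 * M - 2 + ecount T T \<le> 2 * ecount T S \<le> 2 * (card T
      * card A) \<le> 2 * M\<close> has no slack once \<open>ecount T T \<ge> 2\<close>.\<close>
    have eq: "ecount T S = M" "card T * card A = M" and "ecount T T \<le> 2"
      using two pos TS TM AT(5) many' by linarith+
    have full: "card (nbrs S u) = card A" if "u \<in> T" for u
    proof (rule ccontr)
      assume "card (nbrs S u) \<noteq> card A"
      then have "card (nbrs S u) < card A" using AT(1,6) that by (metis UnI2 le_neq_implies_less)
      then have "ecount T S < (\<Sum>u\<in>T. card A)" unfolding ecount_def
        using fin AT(1,6) that by (intro sum_strict_mono_ex1) auto
      then show False using eq by simp
    qed
    have deg: "card (nbrs S u) = card (nbrs A u) + card (nbrs T u)" for u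
      using card_nbrs_Un[OF fin AT(2)] AT(1) by simp
    \<comment> \<open>Both degrees inside \<open>T\<close> are 1, so \<open>x\<close> and
      \<open>y\<close> each miss only one vertex of \<open>A\<close>; yet their neighbourhoods there
      are disjoint, as \<open>xy\<close> lies in no triangle.\<close>
    have ge: "card (nbrs A x) + 1 \<ge> card A" "card (nbrs A y) + 1 \<ge> card A"
      using full[OF xy(1)] full[OF xy(2)] deg[of x] deg[of y] two pos \<open>ecount T T \<le> 2\<close>
      by linarith+
    have "nbrs A x \<inter> nbrs A y = {}"
      using tf E xy AT(1) unfolding triangle_free_def nbrs_def by blast
    moreover have "nbrs A x \<union> nbrs A y \<subseteq> A" by (auto simp: nbrs_def)
    ultimately have "card (nbrs A x) + card (nbrs A y) \<le> card A"
      using fin by (metis card_Un_disjoint card_mono finite_Un finite_subset)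
    then have "card A \<le> 2" using ge by simp
    then have "card T * card A \<le> card T * 2" by simp
    \<comment> \<open>From \<open>8 * n - 3 \<le> 4 * M \<le> 8 * card T\<close> and
      \<open>card T = n - card A\<close>.\<close>
    then have "card A = 0" using eq M n2 cn by linarith
    then show False using eq M n2 n by simp
  qed
  ultimately show ?thesis using AT(3,4) by (intro that[OF AT(1,2)]) auto
qed

end


section \<open>From arcs to unordered edges; isomorphisms\<close>

text \<open>Every fibre of the map to unordered pairs is \<open>{(u, v), (v, u)}\<close>, with two
  distinct elements since there are no loops.\<close>

lemma card_sym_irrefl:
  assumes "finite R" "sym R" "\<And>u. (u, u) \<notin> R"
  shows "card R = 2 * card ((\<lambda>(u, v). {u, v}) ` R)"
proof -
  let ?f = "\<lambda>(u, v). {u, v}"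
  have "card {p \<in> R. ?f p = s} = 2" if s: "s \<in> ?f ` R" for s
  proof -
    obtain u v where uv: "(u, v) \<in> R" "s = {u, v}" using s by auto
    then have "{p \<in> R. ?f p = s} = {(u, v), (v, u)}"
      using assms(2) by (auto simp: doubleton_eq_iff dest: symD)
    moreover have "u \<noteq> v" using uv assms(3) by auto
    ultimately show ?thesis by simp
  qed
  then have "(\<Sum>s\<in>?f ` R. card {p \<in> R. ?f p = s}) = 2 * card (?f ` R)" by simp
  moreover have "card R = (\<Sum>s\<in>?f ` R. card {p \<in> R. ?f p = s})"
    using sum.image_gen[OF assms(1), of "\<lambda>_. 1::nat" ?f] by simp
  ultimately show ?thesis by simp
qed

lemma num_edges_arcs_ends: "num_edges G = card ((\<lambda>(u, v). {u, v}) ` arcs_ends G)"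
  by (simp add: num_edges_def arcs_ends_def arc_to_ends_def image_image)

lemma (in graph) arcs_ends_irrefl: "(u, u) \<notin> arcs_ends G"
  using no_loops by (auto simp: arcs_ends_conv)

lemma (in graph) card_arcs_ends: "card (arcs_ends G) = 2 * num_edges G"
  using card_sym_irrefl[of "arcs_ends G"] sym_arcs arcs_ends_irrefl
  by (simp add: num_edges_arcs_ends symmetric_def arcs_ends_def)

text \<open>The vertex map is injective on \<open>verts G\<close>, so taking images is injective on
  the end sets of arcs.\<close>

lemma num_edges_digraph_iso:
  assumes "digraph_iso G H"
  shows "num_edges H = num_edges G"
proof -
  obtain f where f: "pre_digraph.digraph_isomorphism G f" "H = app_iso f G"
    using assms by (auto simp: digraph_iso_def)
  let ?S = "(\<lambda>a. {tail G a, head G a}) ` arcs G"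
  have inj: "inj_on (iso_verts f) (verts G)" and wf: "wf_digraph G"
    using f(1) by (auto simp: pre_digraph.digraph_isomorphism_def)
  have "(\<lambda>a. {tail H a, head H a}) ` arcs H = image (iso_verts f) ` ?S"
    using f by (auto simp: pre_digraph.digraph_isomorphism_def image_image)
  moreover have "inj_on (image (iso_verts f)) ?S"
    using wf by (intro inj_on_subset[OF inj_on_image_Pow[OF inj]])
      (auto simp: wf_digraph.head_in_verts wf_digraph.tail_in_verts)
  ultimately show ?thesis by (simp add: num_edges_def card_image)
qed

text \<open>Arcs of a pair digraph are their own end pairs, so the vertex map determines the arc
  map; the latter is injective because \<open>G\<close> has no parallel arcs.\<close>

lemma digraph_iso_with_projI:
  assumes "nomulti_digraph G" "bij_betw f (verts G) (pverts P)"
    and arcs: "(\<lambda>(u, v). (f u, f v)) ` arcs_ends G = parcs P"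
  shows "digraph_iso G (with_proj P)"
proof -
  interpret nomulti_digraph G by fact
  let ?h = "\<lparr>iso_verts = f, iso_arcs = \<lambda>a. (f (tail G a), f (head G a)), iso_head = snd, iso_tail = fst\<rparr>"
  have inj: "inj_on f (verts G)" using assms(2) by (auto simp: bij_betw_def)
  have "inj_on (iso_arcs ?h) (arcs G)"
    by (rule inj_onI)
      (use inj in \<open>auto simp: arc_to_ends_def inj_on_eq_iff intro: no_multi_arcs\<close>)
  then have "digraph_isomorphism ?h"
    using inj by (simp add: digraph_isomorphism_def wf_digraph_axioms)
  moreover have "with_proj P = app_iso ?h G"
    using assms(2) arcs
    by (simp add: app_iso_def with_proj_def bij_betw_def arcs_ends_def arc_to_ends_def image_image)
  ultimately show ?thesis by (auto simp: digraph_iso_def)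
qed

section \<open>Two cliques joined by an edge; the barbell graph\<close>

text \<open>A bare relation, so that both \<open>arcs_ends G\<close> and
  \<open>parcs (barbell n)\<close> can be compared with it.\<close>

definition bridged_cliques :: "'a set \<Rightarrow> 'a set \<Rightarrow> 'a \<Rightarrow> 'a \<Rightarrow> 'a rel" where
  "bridged_cliques A B a b =
     {(u, v). u \<noteq> v \<and> (u \<in> A \<and> v \<in> A \<or> u \<in> B \<and> v \<in> B)} \<union> {(a, b), (b, a)}"

lemma card_off_diagonal:
  assumes "finite A"
  shows "finite {(u, v). u \<in> A \<and> v \<in> A \<and> u \<noteq> v}"
    and "card {(u, v). u \<in> A \<and> v \<in> A \<and> u \<noteq> v} = card A * (card A - 1)"
proof -
  have eq: "{(u, v). u \<in> A \<and> v \<in> A \<and> u \<noteq> v} = (SIGMA u:A. A - {u})" by auto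
  show "finite {(u, v). u \<in> A \<and> v \<in> A \<and> u \<noteq> v}" using assms by (simp add: eq)
  show "card {(u, v). u \<in> A \<and> v \<in> A \<and> u \<noteq> v} = card A * (card A - 1)"
    using assms unfolding eq by simp
qed

lemma card_bridged_cliques:
  assumes "finite A" "finite B" "A \<inter> B = {}" "a \<in> A" "b \<in> B"
  shows "card (bridged_cliques A B a b) = card A * (card A - 1) + card B * (card B - 1) + 2"
proof -
  let ?C = "\<lambda>X. {(u, v). u \<in> X \<and> v \<in> X \<and> u \<noteq> v}"
  have "bridged_cliques A B a b = ?C A \<union> (?C B \<union> {(a, b), (b, a)})"
    by (auto simp: bridged_cliques_def)
  moreover have "?C A \<inter> (?C B \<union> {(a, b), (b, a)}) = {}" "?C B \<inter> {(a, b), (b, a)} = {}" "a \<noteq> b"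
    using assms by auto
  ultimately show ?thesis
    using assms by (simp add: card_Un_disjoint card_off_diagonal)
qed

text \<open>Used to match the ends of two bridges: a bijection of the sets without these points is
  extended by one value.\<close>

lemma bij_betw_with_value:
  assumes "finite A" "finite A'" "card A = card A'" "a \<in> A" "a' \<in> A'"
  obtains f where "bij_betw f A A'" "f a = a'"
proof -
  obtain g where g: "bij_betw g (A - {a}) (A' - {a'})"
    using assms finite_same_card_bij[of "A - {a}" "A' - {a'}"] by auto
  moreover have "bij_betw (g(a := a')) (A - {a}) (A' - {a'}) \<longleftrightarrow> bij_betw g (A - {a}) (A' - {a'})"
    by (intro bij_betw_cong) auto
  ultimately have "bij_betw (g(a := a')) (A - {a}) (A' - {a'})" by simp
  then have "bij_betw (g(a := a')) (insert a (A - {a})) (insert a' (A' - {a'}))"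
    by (intro bij_betw_combine[of _ "{a}" "{a'}", simplified]) auto
  then show ?thesis using that[of "g(a := a')"] assms by (simp add: insert_absorb)
qed

text \<open>Any bijection between cliques preserves adjacency, so only the bridge ends have to be
  matched before gluing the two bijections along the disjoint parts.\<close>

lemma bridged_cliques_iso:
  assumes "nomulti_digraph G" "finite (verts G)" "finite (pverts P)"
    and G: "verts G = A \<union> B" "A \<inter> B = {}" "a \<in> A" "b \<in> B" "arcs_ends G = bridged_cliques A B a b"
    and P: "pverts P = A' \<union> B'" "A' \<inter> B' = {}" "a' \<in> A'" "b' \<in> B'"
      "parcs P = bridged_cliques A' B' a' b'"
    and card: "card A = card A'" "card B = card B'"
  shows "digraph_iso G (with_proj P)"
proof -
  have fin: "finite A" "finite B" "finite A'" "finite B'" using assms by auto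
  obtain f where f: "bij_betw f A A'" "f a = a'"
    using bij_betw_with_value fin card G P by metis
  obtain g where g: "bij_betw g B B'" "g b = b'"
    using bij_betw_with_value fin card G P by metis
  define h where "h u = (if u \<in> A then f u else g u)" for u
  have hA: "bij_betw h A A'" using f by (simp add: h_def cong: bij_betw_cong)
  have "h u = g u" if "u \<in> B" for u using that G(2) by (auto simp: h_def)
  then have hB: "bij_betw h B B'" using g by (simp cong: bij_betw_cong)
  have hab: "h a = a'" "h b = b'" using f g G by (auto simp: h_def)
  have bij: "bij_betw h (verts G) (pverts P)"
    using bij_betw_combine[OF hA hB P(2)] G P by simp
  have "(\<lambda>(u, v). (h u, h v)) ` {(u, v). u \<noteq> v \<and> (u \<in> A \<and> v \<in> A \<or> u \<in> B \<and> v \<in> B)} =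
      {(u, v). u \<noteq> v \<and> (u \<in> A' \<and> v \<in> A' \<or> u \<in> B' \<and> v \<in> B')}" (is "?h ` ?L = ?R")
  proof
    show "?h ` ?L \<subseteq> ?R"
      using hA hB by (auto simp: bij_betw_def inj_on_eq_iff)
    show "?R \<subseteq> ?h ` ?L"
    proof
      fix p assume p: "p \<in> ?R"
      obtain x y where xy: "p = (x, y)" by fastforce
      have "\<exists>u v. u \<noteq> v \<and> (u \<in> A \<and> v \<in> A \<or> u \<in> B \<and> v \<in> B) \<and> x = h u \<and> y = h v"
        using p xy hA hB by (auto simp: bij_betw_def; metis)
      then show "p \<in> ?h ` ?L" using xy by force
    qed
  qed
  then have "?h ` arcs_ends G = parcs P"
    unfolding G P bridged_cliques_def by (simp add: image_Un hab)
  then show ?thesis using digraph_iso_with_projI[OF assms(1) bij] by simp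
qed

lemma barbell_eq_bridged_cliques:
  "pverts (barbell n) = {0..<n div 2} \<union> {n div 2..<n}"
  "parcs (barbell n) = bridged_cliques {0..<n div 2} {n div 2..<n} 0 (n div 2)"
  by (auto simp: barbell_def complete_on_def bridged_cliques_def Let_def)

lemma num_edges_barbell:
  assumes "n \<ge> 2"
  shows "num_edges (with_proj (barbell n)) = (n - 1)\<^sup>2 div 4 + 1"
proof -
  interpret pair_graph "barbell n" using assms by (rule pair_graph_barbell)
  define k where "k = n div 2"
  have "2 * num_edges (with_proj (barbell n)) = card (parcs (barbell n))"
    using graph.card_arcs_ends[of "with_proj (barbell n)"] graph_axioms by simp
  also have "\<dots> = k * (k - 1) + (n - k) * (n - k - 1) + 2"
    unfolding barbell_eq_bridged_cliques(2) using assms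
    by (subst card_bridged_cliques) (auto simp: k_def)
  finally have *: "2 * num_edges (with_proj (barbell n)) = k * (k - 1) + (n - k) * (n - k - 1) + 2" .
  have "k \<noteq> 0" using assms by (simp add: k_def)
  \<comment> \<open>Writing \<open>k\<close> as a successor removes the truncated subtraction in
    \<open>k - 1\<close>.\<close>
  then obtain m where m: "k = Suc m" using not0_implies_Suc by blast
  have "n = 2 * k \<or> n = 2 * k + 1" unfolding k_def by presburger
  then show ?thesis
  proof
    assume n: "n = 2 * k"
    have "(n - 1)\<^sup>2 = 4 * (m * m + m) + 1" unfolding n m by (simp add: power2_eq_square algebra_simps)
    then have "(n - 1)\<^sup>2 div 4 = m * m + m" by presburger
    then show ?thesis using * unfolding n m by (simp add: algebra_simps)
  next
    assume n: "n = 2 * k + 1"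
    have "(n - 1)\<^sup>2 = 4 * (k * k)" unfolding n by (simp add: power2_eq_square)
    then show ?thesis using * unfolding n m by (simp add: algebra_simps)
  qed
qed

section \<open>Connected [4,2]-graphs with few edges\<close>

lemma (in graph) connected_crossing_arc:
  assumes "connected G" "verts G = A \<union> B" "A \<inter> B = {}" "A \<noteq> {}" "B \<noteq> {}"
  obtains a b where "a \<in> A" "b \<in> B" "(a, b) \<in> arcs_ends G"
proof -
  obtain x y where xy: "x \<in> A" "y \<in> B" using assms by auto
  \<comment> \<open>\<open>connected\<close> refers to the symmetric closure, whose reachability
    agrees with that of the symmetric digraph \<open>G\<close>.\<close>
  have "x \<rightarrow>\<^sup>*\<^bsub>mk_symmetric G\<^esub> y"
    using assms(1,2) xy by (auto simp: connected_def strongly_connected_def)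
  then have r: "x \<rightarrow>\<^sup>* y" using reachable_mk_symmetric_eq sym_arcs by blast
  have "\<exists>a\<in>A. \<exists>b\<in>B. (a, b) \<in> arcs_ends G"
  proof (rule ccontr)
    assume no: "\<not> ?thesis"
    from r have "y \<in> A"
    proof (induction rule: reachable_induct)
      case base
      then show ?case using xy by simp
    next
      case (step u v)
      then have "v \<in> verts G" by (auto simp: arcs_ends_conv)
      then show ?case using step no assms(2) by auto
    qed
    then show False using xy assms(3) by auto
  qed
  then show ?thesis using that by blast
qed

text \<open>The five non-arcs form a diamond in the complement with shared edge \<open>ab\<close>;
  only \<open>cd\<close> is left as an edge on the four vertices, one too few.\<close>

lemma (in graph) st_graph_4_2_complement:
  assumes "st_graph 4 2 G" "distinct [a, b, c, d]" "{a, b, c, d} \<subseteq> verts G"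
    and "(a, b) \<notin> arcs_ends G" "(a, c) \<notin> arcs_ends G" "(b, c) \<notin> arcs_ends G"
    and "(a, d) \<notin> arcs_ends G" "(b, d) \<notin> arcs_ends G"
  shows False
proof -
  let ?H = "G \<restriction> {a, b, c, d}"
  have "induced_subgraph ?H G" using assms(3) by (rule induced_induce)
  moreover have "card (verts ?H) = 4" using assms(2) by simp
  ultimately have "2 \<le> num_edges ?H" using assms(1) by (auto simp: st_graph_def)
  have sym: "(u, v) \<in> arcs_ends G \<Longrightarrow> (v, u) \<in> arcs_ends G" for u v
    by (rule arcs_ends_symmetric[OF sym_arcs])
  have "(\<lambda>e. {tail ?H e, head ?H e}) ` arcs ?H \<subseteq> {{c, d}}"
  proof
    fix s assume "s \<in> (\<lambda>e. {tail ?H e, head ?H e}) ` arcs ?H"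
    then obtain e where e: "e \<in> arcs G" "tail G e \<in> {a, b, c, d}" "head G e \<in> {a, b, c, d}"
      "s = {tail G e, head G e}"
      by auto
    then have "(tail G e, head G e) \<in> arcs_ends G" by (auto simp: arcs_ends_conv)
    then show "s \<in> {{c, d}}"
      using e(2-) assms(4-) sym arcs_ends_irrefl by (auto simp: insert_commute)
  qed
  then have "num_edges ?H \<le> card {{c, d}}" unfolding num_edges_def by (intro card_mono) auto
  then show False using \<open>2 \<le> num_edges ?H\<close> by simp
qed

lemma (in graph) few_edges_bridged_cliques:
  assumes "connected G" "st_graph 4 2 G" "card (verts G) = n" "n \<ge> 8"
    and few: "num_edges G \<le> (n - 1)\<^sup>2 div 4 + 1"
  obtains A B a b where "verts G = A \<union> B" "A \<inter> B = {}" "a \<in> A" "b \<in> B"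
    "card A = n div 2" "card B = n - n div 2" "arcs_ends G = bridged_cliques A B a b"
proof -
  let ?R = "arcs_ends G" and ?V = "verts G"
  \<comment> \<open>The complement of \<open>G\<close>, cut down to \<open>verts G\<close> because
    the locale takes a relation on the whole type.\<close>
  define E where "E u v \<longleftrightarrow> u \<in> ?V \<and> v \<in> ?V \<and> u \<noteq> v \<and> (u, v) \<notin> ?R" for u v
  have symR: "(u, v) \<in> ?R \<Longrightarrow> (v, u) \<in> ?R" for u v
    by (rule arcs_ends_symmetric[OF sym_arcs])
  have RV: "u \<in> ?V \<and> v \<in> ?V \<and> u \<noteq> v" if "(u, v) \<in> ?R" for u v
    using that arcs_ends_irrefl by (auto simp: arcs_ends_conv)
  interpret adjacency E
    by unfold_locales (auto simp: E_def dest: symR)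
  have finR: "finite ?R" by (simp add: arcs_ends_def)
  have ecount_card: "ecount X Y = card {(u, w). u \<in> X \<and> w \<in> Y \<and> E u w}"
    if "finite X" "finite Y" for X Y
  proof -
    have "{(u, w). u \<in> X \<and> w \<in> Y \<and> E u w} = (SIGMA u:X. nbrs Y u)" by (auto simp: nbrs_def)
    then show ?thesis using that by (simp add: ecount_def nbrs_def)
  qed
  define M where "M = n\<^sup>2 div 4"
  \<comment> \<open>Complementation matches the two bounds exactly: at most
    \<open>(n - 1)\<^sup>2 div 4 + 1\<close> edges in \<open>G\<close> means at least
    \<open>M - 1\<close> in the complement.\<close>
  have nM: "n * (n - 1) = 2 * M + 2 * ((n - 1)\<^sup>2 div 4)"
  proof -
    obtain k where "n = 2 * Suc k \<or> n = 2 * k + 1"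
      using assms(4) by (metis Suc_eq_plus1 evenE not0_implies_Suc mult_zero_right not_numeral_le_zero oddE)
    then show ?thesis
    proof
      assume n: "n = 2 * Suc k"
      have "(n - 1)\<^sup>2 = 4 * (k * k + k) + 1" "n\<^sup>2 = 4 * (k * k + 2 * k + 1)"
        unfolding n by (simp_all add: power2_eq_square algebra_simps)
      then have "(n - 1)\<^sup>2 div 4 = k * k + k" "M = k * k + 2 * k + 1"
        unfolding M_def by presburger+
      then show ?thesis unfolding n by (simp add: algebra_simps)
    next
      assume n: "n = 2 * k + 1"
      have "(n - 1)\<^sup>2 = 4 * (k * k)" "n\<^sup>2 = 4 * (k * k + k) + 1"
        unfolding n by (simp_all add: power2_eq_square algebra_simps)
      then have "(n - 1)\<^sup>2 div 4 = k * k" "M = k * k + k"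
        unfolding M_def by presburger+
      then show ?thesis unfolding n by (simp add: algebra_simps)
    qed
  qed
  have "{(u, v). u \<in> ?V \<and> v \<in> ?V \<and> u \<noteq> v} = ?R \<union> {(u, v). u \<in> ?V \<and> v \<in> ?V \<and> E u v}"
    using RV by (auto simp: E_def)
  moreover have "?R \<inter> {(u, v). u \<in> ?V \<and> v \<in> ?V \<and> E u v} = {}" by (auto simp: E_def)
  moreover have "finite {(u, v). u \<in> ?V \<and> v \<in> ?V \<and> E u v}"
    by (rule finite_subset[of _ "?V \<times> ?V"]) auto
  ultimately have "n * (n - 1) = 2 * num_edges G + ecount ?V ?V"
    using card_off_diagonal(2)[of ?V] finR assms(3)
    by (simp add: card_Un_disjoint card_arcs_ends ecount_card)
  then have many: "ecount ?V ?V + 2 \<ge> 2 * M" using few nM by linarith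
  have "diamond_free ?V"
    unfolding diamond_free_def
  proof (intro ballI impI, elim conjE, rule ccontr)
    fix a b c d assume "a \<in> ?V" "b \<in> ?V" "c \<in> ?V" "d \<in> ?V"
      "E a b" "E a c" "E b c" "E a d" "E b d" "c \<noteq> d"
    then show False using st_graph_4_2_complement[OF assms(2), of a b c d] by (auto simp: E_def)
  qed
  then obtain A B where AB: "?V = A \<union> B" "A \<inter> B = {}" "A \<noteq> {}" "B \<noteq> {}"
    "\<And>u w. u \<in> A \<Longrightarrow> w \<in> A \<Longrightarrow> \<not> E u w" "\<And>u w. u \<in> B \<Longrightarrow> w \<in> B \<Longrightarrow> \<not> E u w"
    using diamond_free_extremal[of ?V] many assms(3,4) unfolding M_def by auto
  have fin: "finite A" "finite B" using AB(1) finite_verts by (metis finite_Un)+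
  obtain a b where ab: "a \<in> A" "b \<in> B" "(a, b) \<in> ?R"
    using connected_crossing_arc[OF assms(1) AB(1-4)] by metis
  have cn: "card A + card B = n" using AB(1,2) fin assms(3) by (metis card_Un_disjoint)
  let ?K = "{(u, w). u \<in> A \<and> w \<in> B \<and> (u, w) \<in> ?R}"
  let ?N = "{(u, w). u \<in> A \<and> w \<in> B \<and> E u w}"
  have finK: "finite ?K" "finite ?N" by (rule finite_subset[of _ "A \<times> B"]; use fin in auto)+
  have split: "A \<times> B = ?K \<union> ?N" and disj: "?K \<inter> ?N = {}" using AB(1,2) by (auto simp: E_def)
  have KN: "card A * card B = card ?K + card ?N"
    unfolding card_cartesian_product[symmetric] split by (rule card_Un_disjoint[OF finK disj])
  have "ecount A A = 0" "ecount B B = 0" using AB(5,6) fin by (simp_all add: ecount_eq_0_iff)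
  then have VV: "ecount ?V ?V = 2 * card ?N"
    using ecount_Un_self[OF fin AB(2)] AB(1) fin by (simp add: ecount_card)
  have "4 * (card A * card B) \<le> n\<^sup>2" using four_mult_le_square cn by metis
  then have "card A * card B \<le> M" unfolding M_def by simp
  moreover have "card ?K \<ge> 1" using ab finK by (auto simp: Suc_le_eq card_gt_0_iff)
  \<comment> \<open>\<open>?N\<close> has at least \<open>M - 1\<close> elements and
    \<open>?K\<close> at least one, while together they have at most \<open>M\<close>; so all three
    bounds are attained.\<close>
  ultimately have K1: "card ?K = 1" and ABM: "card A * card B = M" using KN VV many by linarith+
  then obtain p where "?K = {p}" by (auto simp: card_1_singleton_iff)
  then have K: "?K = {(a, b)}" using ab by auto
  have R: "?R = bridged_cliques A B a b"
  proof (intro set_eqI iffI)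
    fix p assume p: "p \<in> ?R"
    obtain u v where uv: "p = (u, v)" by fastforce
    have "u \<noteq> v" "u \<in> A \<union> B" "v \<in> A \<union> B" using RV p uv AB(1) by auto
    moreover have "(u, v) = (a, b)" if "u \<in> A" "v \<in> B" using K that p uv by blast
    moreover have "(v, u) = (a, b)" if "v \<in> A" "u \<in> B" using K that p uv symR by blast
    ultimately show "p \<in> bridged_cliques A B a b" unfolding uv bridged_cliques_def by auto
  next
    fix p assume "p \<in> bridged_cliques A B a b"
    moreover have "(u, v) \<in> ?R" if "u \<noteq> v" "u \<in> A \<and> v \<in> A \<or> u \<in> B \<and> v \<in> B" for u v
      using that AB(1,5,6) unfolding E_def by blast
    ultimately show "p \<in> ?R" using ab(3) symR by (auto simp: bridged_cliques_def)
  qed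
  \<comment> \<open>The swapped form serves the case in which \<open>B\<close> is the smaller
    clique.\<close>
  then have R': "?R = bridged_cliques B A b a" by (auto simp: bridged_cliques_def)
  \<comment> \<open>With \<open>d = y - x\<close>, the identity
    \<open>(x + y)\<^sup>2 = 4 * (x * y) + d\<^sup>2\<close> turns the maximality of the product
    into \<open>d\<^sup>2 \<le> 3\<close>.\<close>
  have balanced: "x = n div 2" if "x \<le> y" "x + y = n" "x * y = M" for x y
  proof -
    obtain d where d: "y = x + d" using \<open>x \<le> y\<close> le_Suc_ex by blast
    have "n\<^sup>2 = 4 * M + d\<^sup>2"
      using that(2,3) unfolding d by (auto simp: power2_eq_square algebra_simps)
    moreover have "n\<^sup>2 \<le> 4 * M + 3" unfolding M_def by presburger
    ultimately have "d\<^sup>2 \<le> 3" by simp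
    have "d \<le> 1"
    proof (rule ccontr)
      assume "\<not> d \<le> 1"
      then have "2\<^sup>2 \<le> d\<^sup>2" by (intro power_mono) auto
      then show False using \<open>d\<^sup>2 \<le> 3\<close> by simp
    qed
    then show ?thesis using that(2) d by linarith
  qed
  show ?thesis
  proof (cases "card A \<le> card B")
    case True
    then have "card A = n div 2" using balanced cn ABM by blast
    then show ?thesis using that[OF AB(1,2) ab(1,2) _ _ R] cn by simp
  next
    case False
    then have "card B = n div 2" using balanced[of "card B" "card A"] cn ABM by (simp add: ac_simps)
    then show ?thesis using that[of B A b a] R' AB(1,2) ab cn by (auto simp: Un_commute Int_commute)
  qed
qed

theorem theorem10:
  fixes G :: "('a, 'b) pre_digraph" and n :: nat
  assumes "graph G"
    and "connected G"
    and "st_graph 4 2 G"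
    and "card (verts G) = n"
    and "n \<ge> 8"
  shows "num_edges G \<ge> (n - 1)\<^sup>2 div 4 + 1 \<and>
    (num_edges G = (n - 1)\<^sup>2 div 4 + 1 \<longleftrightarrow> digraph_iso G (with_proj (barbell n)))"
proof -
  interpret graph G by fact
  \<comment> \<open>Assuming only an upper bound yields both claims: such a graph is the barbell,
    whose edge number is exactly this bound, so no graph falls below it.\<close>
  have iso: "digraph_iso G (with_proj (barbell n))" if few: "num_edges G \<le> (n - 1)\<^sup>2 div 4 + 1"
  proof -
    obtain A B a b where AB: "verts G = A \<union> B" "A \<inter> B = {}" "a \<in> A" "b \<in> B"
      "card A = n div 2" "card B = n - n div 2" "arcs_ends G = bridged_cliques A B a b"
      using few_edges_bridged_cliques[OF assms(2-5) few] by metis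
    show ?thesis
      by (rule bridged_cliques_iso[OF nomulti_digraph_axioms _ _ AB(1-4,7)
            barbell_eq_bridged_cliques(1) _ _ _ barbell_eq_bridged_cliques(2)])
        (use assms(5) AB(5,6) in \<open>auto simp: barbell_eq_bridged_cliques(1)\<close>)
  qed
  have "num_edges G = (n - 1)\<^sup>2 div 4 + 1" if "digraph_iso G (with_proj (barbell n))"
    using num_edges_digraph_iso[OF that] num_edges_barbell assms(5) by simp
  then show ?thesis using iso by (metis nat_le_linear)
qed

end
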